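(* Let $F=\{F_1,\dots,F_m\}$ where $F_i(x_1,\dots,x_n)=\sum_{k,\ell=1}^n t_{ik\ell}x_kx_\ell$ with real coefficients $t_{ik\ell}$. If there is an extended arithmetic circuit of size $s$ computing $F$, then there is an arithmetic circuit of size $O(s)$ computing $F$.
   Context: An arithmetic circuit (AC) is a sequence of gates $g_1,\dots,g_s$, each of the form $g_j\gets y\circ z$ with $\circ\in\{+,-,\times,/\}$ and $y,z\in\{g_i\}_{i<j}\cup\{x_i\}\cup\mathbb{R}$, with a designated subset of output gates; its size is the number of gates. An extended arithmetic circuit (eAC) additionally allows gates $g_j\gets\exp(y)$ with $y\in\{g_i\}_{i<j}\cup\{x_i\}\cup\mathbb{R}$ and $g_j\gets\ln(y)$ with $y\in\{g_i\}_{i<j}\cup\{x_i\}\cup\mathbb{R}_{>0}$. A circuit computes $F:\mathbb{R}^n\to\mathbb{R}^m$ if its output gates evaluate to $F(x)$ for all $x\in\mathbb{R}^n$ (in particular all its gates are well defined on every input: arguments of $\ln$ gates are positive and denominators of division gates are nonzero for all $x$). *)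

theory Defs
  imports Complex_Main
begin

text \<open>Gates and input variables are indexed from 0. A vector of \<open>\<real>\<^sup>n\<close> is a real list of length \<open>n\<close>:
  the constant hidden in \<open>O(s)\<close> must not depend on the dimensions, so these are quantified
  inside the statement and cannot be types.\<close>

datatype operand = Gate nat | Input nat | Const real

datatype gate =
    Add operand operand
  | Sub operand operand
  | Mul operand operand
  | Div operand operand
  | Exp operand
  | Ln operand

text \<open>\<open>outputs\<close> enumerates the designated output gates, in the order of the components of the
  computed map; as it stands for a subset of the gates, it is required to be distinct below.\<close>

datatype circuit = Circuit (gates: "gate list") (outputs: "nat list")

definition circuit_size :: "circuit \<Rightarrow> nat" where
  "circuit_size c = length (gates c)"

text \<open>Syntactic conditions, for \<open>n\<close> input variables; \<open>j\<close> is the position of the gate at hand.\<close>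

fun operand_ok :: "nat \<Rightarrow> nat \<Rightarrow> operand \<Rightarrow> bool" where
  "operand_ok n j (Gate i) \<longleftrightarrow> i < j"
| "operand_ok n j (Input i) \<longleftrightarrow> i < n"
| "operand_ok n j (Const a) \<longleftrightarrow> True"

fun gate_ok :: "nat \<Rightarrow> nat \<Rightarrow> gate \<Rightarrow> bool" where
  "gate_ok n j (Add y z) \<longleftrightarrow> operand_ok n j y \<and> operand_ok n j z"
| "gate_ok n j (Sub y z) \<longleftrightarrow> operand_ok n j y \<and> operand_ok n j z"
| "gate_ok n j (Mul y z) \<longleftrightarrow> operand_ok n j y \<and> operand_ok n j z"
| "gate_ok n j (Div y z) \<longleftrightarrow> operand_ok n j y \<and> operand_ok n j z"
| "gate_ok n j (Exp y) \<longleftrightarrow> operand_ok n j y"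
| "gate_ok n j (Ln y) \<longleftrightarrow> operand_ok n j y \<and> (\<forall>a. y = Const a \<longrightarrow> a > 0)"

fun arith_gate :: "gate \<Rightarrow> bool" where
  "arith_gate (Exp y) \<longleftrightarrow> False"
| "arith_gate (Ln y) \<longleftrightarrow> False"
| "arith_gate _ \<longleftrightarrow> True"

definition ext_arith_circuit :: "nat \<Rightarrow> circuit \<Rightarrow> bool" where
  "ext_arith_circuit n c \<longleftrightarrow>
     (\<forall>j < length (gates c). gate_ok n j (gates c ! j)) \<and>
     distinct (outputs c) \<and> set (outputs c) \<subseteq> {..<length (gates c)}"

definition arith_circuit :: "nat \<Rightarrow> circuit \<Rightarrow> bool" where
  "arith_circuit n c \<longleftrightarrow> ext_arith_circuit n c \<and> (\<forall>g \<in> set (gates c). arith_gate g)"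

text \<open>Semantics on input \<open>x\<close>; \<open>vs\<close> lists the values of the preceding gates.\<close>

fun operand_val :: "real list \<Rightarrow> real list \<Rightarrow> operand \<Rightarrow> real" where
  "operand_val x vs (Gate i) = vs ! i"
| "operand_val x vs (Input i) = x ! i"
| "operand_val x vs (Const a) = a"

fun gate_val :: "real list \<Rightarrow> real list \<Rightarrow> gate \<Rightarrow> real" where
  "gate_val x vs (Add y z) = operand_val x vs y + operand_val x vs z"
| "gate_val x vs (Sub y z) = operand_val x vs y - operand_val x vs z"
| "gate_val x vs (Mul y z) = operand_val x vs y * operand_val x vs z"
| "gate_val x vs (Div y z) = operand_val x vs y / operand_val x vs z"
| "gate_val x vs (Exp y) = exp (operand_val x vs y)"
| "gate_val x vs (Ln y) = ln (operand_val x vs y)"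

fun gate_defined :: "real list \<Rightarrow> real list \<Rightarrow> gate \<Rightarrow> bool" where
  "gate_defined x vs (Div y z) \<longleftrightarrow> operand_val x vs z \<noteq> 0"
| "gate_defined x vs (Ln y) \<longleftrightarrow> operand_val x vs y > 0"
| "gate_defined x vs _ \<longleftrightarrow> True"

definition gate_vals :: "real list \<Rightarrow> gate list \<Rightarrow> real list" where
  "gate_vals x gs = foldl (\<lambda>vs g. vs @ [gate_val x vs g]) [] gs"

definition well_defined_on :: "real list \<Rightarrow> circuit \<Rightarrow> bool" where
  "well_defined_on x c \<longleftrightarrow>
     (\<forall>j < length (gates c). gate_defined x (gate_vals x (take j (gates c))) (gates c ! j))"

definition output_vals :: "real list \<Rightarrow> circuit \<Rightarrow> real list" where
  "output_vals x c = map (\<lambda>j. gate_vals x (gates c) ! j) (outputs c)"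

definition computes :: "nat \<Rightarrow> circuit \<Rightarrow> (real list \<Rightarrow> real list) \<Rightarrow> bool" where
  "computes n c F \<longleftrightarrow> (\<forall>x. length x = n \<longrightarrow> well_defined_on x c \<and> output_vals x c = F x)"

definition quadratic_map ::
  "nat \<Rightarrow> nat \<Rightarrow> (nat \<Rightarrow> nat \<Rightarrow> nat \<Rightarrow> real) \<Rightarrow> real list \<Rightarrow> real list" where
  "quadratic_map n m t x = map (\<lambda>i. \<Sum>k<n. \<Sum>l<n. t i k l * x ! k * x ! l) [0..<m]"

end

theory Submission
  imports Defs "HOL-Real_Asymp.Real_Asymp"
begin

text \<open>Fix \<open>x\<close> and follow every gate of the extended circuit along the ray \<open>e \<mapsto> e x\<close>. Since the
  circuit is well defined at the origin, each gate has an expansion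
  \<open>a + e L(x) + e\<^sup>2 Q(x) + o(e\<^sup>2)\<close> whose constant term \<open>a\<close> does not depend on \<open>x\<close>. By the
  second-order chain rule, \<open>L\<close> and \<open>Q\<close> of a gate are obtained from those of its operands by a
  constant number of additions and multiplications; even for division, \<open>exp\<close> and \<open>ln\<close>, the
  coefficients involved are constants determined by the values at the origin. For an output gate,
  homogeneity of \<open>F\<close> forces \<open>Q = F\<^sub>i\<close>.\<close>

section \<open>Second-order expansions at zero\<close>

text \<open>For \<open>e \<noteq> 0\<close> the equation just defines \<open>h e\<close>, and at
  \<open>e = 0\<close> it is trivial, so demanding it for all \<open>e\<close> costs nothing and
  avoids reasoning "near 0". Only the limit of \<open>h\<close> has content: \<open>Q\<close> is the
  coefficient of e^2, without factor 2.\<close>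

definition expands2 :: "(real \<Rightarrow> real) \<Rightarrow> real \<Rightarrow> real \<Rightarrow> bool" where
  "expands2 f L Q \<longleftrightarrow> (\<exists>h. (h \<longlongrightarrow> Q) (at 0) \<and> (\<forall>e. f e = f 0 + e * L + e\<^sup>2 * h e))"

lemma expands2_const: "expands2 (\<lambda>e. c) 0 0"
  unfolding expands2_def by (intro exI[of _ "\<lambda>_. 0"]) auto

lemma expands2_linear: "expands2 (\<lambda>e. e * c) c 0"
  unfolding expands2_def by (intro exI[of _ "\<lambda>_. 0"]) auto

lemma expands2_add:
  assumes "expands2 f L Q" "expands2 g M R"
  shows "expands2 (\<lambda>e. f e + g e) (L + M) (Q + R)"
proof -
  obtain h k where h: "(h \<longlongrightarrow> Q) (at 0)" "\<And>e. f e = f 0 + e * L + e\<^sup>2 * h e"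
    and k: "(k \<longlongrightarrow> R) (at 0)" "\<And>e. g e = g 0 + e * M + e\<^sup>2 * k e"
    using assms unfolding expands2_def by metis
  have "f e + g e = f 0 + g 0 + e * (L + M) + e\<^sup>2 * (h e + k e)" for e
    using h(2)[of e] k(2)[of e] by (simp add: algebra_simps)
  with tendsto_add[OF h(1) k(1)] show ?thesis
    unfolding expands2_def by blast
qed

lemma expands2_mult:
  assumes "expands2 f L Q" "expands2 g M R"
  shows "expands2 (\<lambda>e. f e * g e) (f 0 * M + L * g 0) (f 0 * R + Q * g 0 + L * M)"
proof -
  obtain h k where h: "(h \<longlongrightarrow> Q) (at 0)" "\<And>e. f e = f 0 + e * L + e\<^sup>2 * h e"
    and k: "(k \<longlongrightarrow> R) (at 0)" "\<And>e. g e = g 0 + e * M + e\<^sup>2 * k e"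
    using assms unfolding expands2_def by metis
  \<comment> \<open>The product of both expansions, with orders 0 and 1 removed and e^2 divided
    out.\<close>
  define r where
    "r e = f 0 * k e + h e * g 0 + L * M + e * (L * k e + h e * M) + e\<^sup>2 * (h e * k e)" for e
  have "(r \<longlongrightarrow> f 0 * R + Q * g 0 + L * M + 0 * (L * R + Q * M) + 0\<^sup>2 * (Q * R)) (at 0)"
    unfolding r_def by (intro tendsto_intros h k)
  hence "(r \<longlongrightarrow> f 0 * R + Q * g 0 + L * M) (at 0)"
    by simp
  moreover have "f e * g e = f 0 * g 0 + e * (f 0 * M + L * g 0) + e\<^sup>2 * r e" for e
    unfolding r_def by (subst h(2)[of e], subst k(2)[of e]) (simp add: algebra_simps power2_eq_square)
  ultimately show ?thesis
    unfolding expands2_def by blast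
qed

lemma expands2_cmult: "expands2 f L Q \<Longrightarrow> expands2 (\<lambda>e. c * f e) (c * L) (c * Q)"
  using expands2_mult[OF expands2_const] by simp

lemma expands2_diff:
  assumes "expands2 f L Q" "expands2 g M R"
  shows "expands2 (\<lambda>e. f e - g e) (L - M) (Q - R)"
  using expands2_add[OF assms(1) expands2_cmult[OF assms(2), of "-1"]] by simp

section \<open>Second-order chain rule for functions of one variable\<close>

text \<open>The Taylor expansion of \<open>\<phi>\<close> at \<open>f 0\<close> is assumed as one
  limit, so \<open>d1\<close> is the derivative there and \<open>d2\<close> plays the role of half
  the second derivative. Inserting the increment of \<open>f\<close> gives the result.\<close>

lemma expands2_compose:
  assumes f: "expands2 f L Q"
    and \<phi>: "((\<lambda>u. (\<phi> (f 0 + u) - \<phi> (f 0) - u * d1) / u\<^sup>2) \<longlongrightarrow> d2) (at 0)"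
  shows "expands2 (\<lambda>e. \<phi> (f e)) (d1 * L) (d1 * Q + d2 * L\<^sup>2)"
proof -
  obtain h where h: "(h \<longlongrightarrow> Q) (at 0)" "\<And>e. f e = f 0 + e * L + e\<^sup>2 * h e"
    using f unfolding expands2_def by metis
  \<comment> \<open>The increment of \<open>f\<close> can vanish for \<open>e \<noteq> 0\<close>,
    for instance if \<open>f\<close> is constant. Filling in \<open>d2\<close> at 0 makes
    \<open>g\<close> continuous there, so it can be composed with that increment.\<close>
  define g where "g u = (if u = 0 then d2 else (\<phi> (f 0 + u) - \<phi> (f 0) - u * d1) / u\<^sup>2)" for u
  have "(g \<longlongrightarrow> d2) (at 0)"
    by (rule Lim_transform_eventually[OF \<phi>]) (auto simp: g_def eventually_at_filter)
  hence g: "isCont g 0"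
    by (simp add: isCont_def g_def)
  have g0: "g 0 = d2"
    by (simp add: g_def)
  have \<phi>_eq: "\<phi> (f 0 + u) = \<phi> (f 0) + u * d1 + u\<^sup>2 * g u" for u
    by (simp add: g_def)
  define r where "r e = d1 * h e + g (e * (L + e * h e)) * (L + e * h e)\<^sup>2" for e
  have "((\<lambda>e. e * (L + e * h e)) \<longlongrightarrow> 0 * (L + 0 * Q)) (at 0)"
    by (intro tendsto_intros h)
  hence "((\<lambda>e. g (e * (L + e * h e))) \<longlongrightarrow> d2) (at 0)"
    using isCont_tendsto_compose[OF g, of "\<lambda>e. e * (L + e * h e)" "at 0"] g0 by simp
  hence "(r \<longlongrightarrow> d1 * Q + d2 * (L + 0 * Q)\<^sup>2) (at 0)"
    unfolding r_def by (intro tendsto_intros h)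
  hence "(r \<longlongrightarrow> d1 * Q + d2 * L\<^sup>2) (at 0)"
    by simp
  moreover have "\<phi> (f e) = \<phi> (f 0) + e * (d1 * L) + e\<^sup>2 * r e" for e
  proof -
    have "f e = f 0 + e * (L + e * h e)"
      using h(2)[of e] by (simp add: algebra_simps power2_eq_square)
    hence "\<phi> (f e) = \<phi> (f 0) + e * (L + e * h e) * d1
        + (e * (L + e * h e))\<^sup>2 * g (e * (L + e * h e))"
      using \<phi>_eq by metis
    thus ?thesis
      unfolding r_def by (simp only: power_mult_distrib) (simp only: algebra_simps power2_eq_square)
  qed
  ultimately show ?thesis
    unfolding expands2_def by blast
qed

lemma expands2_exp:
  assumes "expands2 f L Q"
  shows "expands2 (\<lambda>e. exp (f e)) (exp (f 0) * L) (exp (f 0) * Q + exp (f 0) / 2 * L\<^sup>2)"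
proof (rule expands2_compose[OF assms])
  have "((\<lambda>u::real. (exp u - 1 - u) / u\<^sup>2) \<longlongrightarrow> 1 / 2) (at 0)"
    by real_asymp
  from tendsto_mult_left[OF this, of "exp (f 0)"]
  show "((\<lambda>u. (exp (f 0 + u) - exp (f 0) - u * exp (f 0)) / u\<^sup>2) \<longlongrightarrow> exp (f 0) / 2) (at 0)"
    by (simp add: exp_add algebra_simps)
qed

text \<open>The substitution \<open>v = u / a\<close> reduces the limit to that of
  \<open>ln (1 + v)\<close> at 0; the logarithm of the quotient splits because
  \<open>a + u > 0\<close> near 0.\<close>

lemma expands2_ln:
  assumes "expands2 f L Q" "f 0 > 0"
  shows "expands2 (\<lambda>e. ln (f e)) (1 / f 0 * L) (1 / f 0 * Q + (- 1 / (2 * (f 0)\<^sup>2)) * L\<^sup>2)"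
proof (rule expands2_compose[OF assms(1)])
  define a where "a = f 0"
  have a: "a > 0"
    using assms(2) by (simp add: a_def)
  have "((\<lambda>v::real. (ln (1 + v) - v) / v\<^sup>2) \<longlongrightarrow> - 1 / 2) (at 0)"
    by real_asymp
  moreover have "filterlim (\<lambda>u. u / a) (at 0) (at 0)"
    using a by real_asymp
  ultimately have "((\<lambda>u. (ln (1 + u / a) - u / a) / (u / a)\<^sup>2) \<longlongrightarrow> - 1 / 2) (at 0)"
    by (rule filterlim_compose)
  from tendsto_mult_left[OF this, of "1 / a\<^sup>2"]
  have "((\<lambda>u. (ln (1 + u / a) - u / a) / u\<^sup>2) \<longlongrightarrow> - 1 / (2 * a\<^sup>2)) (at 0)"
    using a by (simp add: power_divide mult.commute)
  moreover have "\<forall>\<^sub>F u in at 0. (ln (1 + u / a) - u / a) / u\<^sup>2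
      = (ln (a + u) - ln a - u * (1 / a)) / u\<^sup>2"
  proof -
    have "((\<lambda>u. a + u) \<longlongrightarrow> a + 0) (at 0)"
      by (intro tendsto_intros)
    hence "\<forall>\<^sub>F u in at 0. a + u > 0"
      using a by (intro order_tendstoD) auto
    thus ?thesis
    proof eventually_elim
      case (elim u)
      have "1 + u / a = (a + u) / a"
        using a by (simp add: field_simps)
      thus ?case
        using a elim by (simp add: ln_div)
    qed
  qed
  ultimately show "((\<lambda>u. (ln (f 0 + u) - ln (f 0) - u * (1 / f 0)) / u\<^sup>2)
      \<longlongrightarrow> - 1 / (2 * (f 0)\<^sup>2)) (at 0)"
    unfolding a_def by (rule Lim_transform_eventually)
qed

text \<open>With \<open>a = f 0\<close>, the second-order quotient of the reciprocal equals
  \<open>1 / (a^2 * (a + u))\<close> near 0 except at 0, and this is continuous at 0.\<close>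

lemma expands2_inverse:
  assumes "expands2 f L Q" "f 0 \<noteq> 0"
  shows "expands2 (\<lambda>e. inverse (f e)) (- 1 / (f 0)\<^sup>2 * L) (- 1 / (f 0)\<^sup>2 * Q + 1 / (f 0) ^ 3 * L\<^sup>2)"
proof (rule expands2_compose[OF assms(1)])
  have "((\<lambda>u. 1 / ((f 0)\<^sup>2 * (f 0 + u))) \<longlongrightarrow> 1 / ((f 0)\<^sup>2 * (f 0 + 0))) (at 0)"
    using assms(2) by (intro tendsto_intros) auto
  moreover have "\<forall>\<^sub>F u in at 0. 1 / ((f 0)\<^sup>2 * (f 0 + u)) =
      (inverse (f 0 + u) - inverse (f 0) - u * (- 1 / (f 0)\<^sup>2)) / u\<^sup>2"
  proof -
    have "((\<lambda>u. f 0 + u) \<longlongrightarrow> f 0 + 0) (at 0)"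
      by (intro tendsto_intros)
    hence "\<forall>\<^sub>F u in at 0. f 0 + u \<noteq> 0"
      using assms(2) by (intro tendsto_imp_eventually_ne) auto
    moreover have "\<forall>\<^sub>F u in at 0. u \<noteq> (0::real)"
      by (simp add: eventually_at_filter)
    ultimately show ?thesis
    proof eventually_elim
      case (elim u)
      have "inverse (f 0 + u) - inverse (f 0) - u * (- 1 / (f 0)\<^sup>2)
          = u\<^sup>2 / ((f 0)\<^sup>2 * (f 0 + u))"
        using elim assms(2) by (simp add: divide_simps) (simp add: algebra_simps power2_eq_square)
      with elim show ?case by simp
    qed
  qed
  ultimately have "((\<lambda>u. (inverse (f 0 + u) - inverse (f 0) - u * (- 1 / (f 0)\<^sup>2)) / u\<^sup>2)
      \<longlongrightarrow> 1 / ((f 0)\<^sup>2 * (f 0 + 0))) (at 0)"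
    by (rule Lim_transform_eventually)
  thus "((\<lambda>u. (inverse (f 0 + u) - inverse (f 0) - u * (- 1 / (f 0)\<^sup>2)) / u\<^sup>2)
      \<longlongrightarrow> 1 / (f 0) ^ 3) (at 0)"
    by (simp add: power2_eq_square power3_eq_cube)
qed

text \<open>Uniqueness of the coefficients: dividing by \<open>e\<close> and letting
  \<open>e\<close> tend to 0 gives \<open>L = 0\<close>, whence \<open>h\<close> equals
  \<open>c\<close> away from 0.\<close>

lemma expands2_homogeneous:
  assumes "expands2 (\<lambda>e. e\<^sup>2 * c) L Q"
  shows "Q = c"
proof -
  obtain h where h: "(h \<longlongrightarrow> Q) (at 0)" "\<And>e. e\<^sup>2 * c = e * L + e\<^sup>2 * h e"
    using assms unfolding expands2_def by auto
  have L: "L = e * (c - h e)" if "e \<noteq> 0" for e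
  proof -
    have "e * L = e * (e * (c - h e))"
      using h(2)[of e] by (simp add: algebra_simps power2_eq_square)
    with that show ?thesis by simp
  qed
  have "((\<lambda>e. e * (c - h e)) \<longlongrightarrow> 0 * (c - Q)) (at 0)"
    by (intro tendsto_intros h)
  moreover have "\<forall>\<^sub>F e in at 0. e * (c - h e) = L"
    using L by (auto simp: eventually_at_filter)
  ultimately have "((\<lambda>e::real. L) \<longlongrightarrow> 0) (at 0)"
    by (auto intro: Lim_transform_eventually)
  hence "L = 0"
    by (simp add: tendsto_const_iff)
  hence "\<forall>\<^sub>F e in at 0. h e = c"
    using L by (auto simp: eventually_at_filter)
  with h(1) have "((\<lambda>e::real. c) \<longlongrightarrow> Q) (at 0)"
    by (rule Lim_transform_eventually)
  thus ?thesis
    by (simp add: tendsto_const_iff)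
qed

section \<open>Evaluation of gate lists\<close>

lemma gate_vals_Nil [simp]: "gate_vals x [] = []"
  by (simp add: gate_vals_def)

lemma gate_vals_append:
  "gate_vals x (gs @ hs) = foldl (\<lambda>vs g. vs @ [gate_val x vs g]) (gate_vals x gs) hs"
  by (simp add: gate_vals_def)

lemma gate_vals_snoc:
  "gate_vals x (gs @ [g]) = gate_vals x gs @ [gate_val x (gate_vals x gs) g]"
  by (simp add: gate_vals_append)

lemma length_gate_vals [simp]: "length (gate_vals x gs) = length gs"
  by (induction gs rule: rev_induct) (simp_all add: gate_vals_snoc)

lemma operand_val_append:
  "operand_ok n (length vs) y \<Longrightarrow> operand_val x (vs @ ws) y = operand_val x vs y"
  by (cases y) (auto simp: nth_append)

lemma gate_val_append:
  "gate_ok n (length vs) g \<Longrightarrow> gate_val x (vs @ ws) g = gate_val x vs g"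
  by (cases g) (auto simp: operand_val_append)

lemma gate_vals_prefix: "\<exists>ws. gate_vals x (gs @ hs) = gate_vals x gs @ ws"
proof (induction hs rule: rev_induct)
  case (snoc h hs)
  thus ?case
    using gate_vals_snoc[of x "gs @ hs" h] by auto
qed simp

text \<open>A well-formed gate refers only to earlier gates, so it may be evaluated against the full
  list of values. This turns evaluation into a system of equations on one list.\<close>

lemma gate_vals_nth:
  assumes "j < length gs" "gate_ok n j (gs ! j)"
  shows "gate_vals x gs ! j = gate_val x (gate_vals x gs) (gs ! j)"
proof -
  obtain ws where ws: "gate_vals x (take (Suc j) gs @ drop (Suc j) gs)
      = gate_vals x (take (Suc j) gs) @ ws"
    using gate_vals_prefix by blast
  have "gate_vals x gs = gate_vals x (take j gs) @ gate_val x (gate_vals x (take j gs)) (gs ! j) # ws"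
    using ws unfolding append_take_drop_id
    by (simp add: take_Suc_conv_app_nth[OF assms(1)] gate_vals_snoc)
  with assms show ?thesis
    by (simp add: nth_append gate_val_append)
qed

lemma operand_ok_mono: "operand_ok n i y \<Longrightarrow> i \<le> j \<Longrightarrow> operand_ok n j y"
  by (cases y) auto

section \<open>The arithmetic circuit of the expansion coefficients\<close>

text \<open>Unary gates count as binary ones with both operands equal, so that a single scheme
  \<open>L = \<alpha> L\<^sub>1 + \<beta> L\<^sub>2\<close>, \<open>Q = \<alpha> Q\<^sub>1 + \<beta> Q\<^sub>2 + L\<^sub>2 (\<gamma> L\<^sub>1 + \<delta> L\<^sub>2)\<close> covers all gates.\<close>

fun left_operand :: "gate \<Rightarrow> operand" where
  "left_operand (Add y z) = y"
| "left_operand (Sub y z) = y"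
| "left_operand (Mul y z) = y"
| "left_operand (Div y z) = y"
| "left_operand (Exp y) = y"
| "left_operand (Ln y) = y"

fun right_operand :: "gate \<Rightarrow> operand" where
  "right_operand (Add y z) = z"
| "right_operand (Sub y z) = z"
| "right_operand (Mul y z) = z"
| "right_operand (Div y z) = z"
| "right_operand (Exp y) = y"
| "right_operand (Ln y) = y"

text \<open>For binary gates: the two first partial derivatives at \<open>(a, b)\<close>, the mixed
  one, and half the second one in \<open>b\<close>. These gates are all affine in the first operand,
  so no square of \<open>L\<^sub>1\<close> occurs. For unary gates
  \<open>L\<^sub>1 = L\<^sub>2\<close>, and \<open>\<gamma>\<close> holds half the second
  derivative.\<close>

fun chain_coeffs :: "gate \<Rightarrow> real \<Rightarrow> real \<Rightarrow> real \<times> real \<times> real \<times> real" where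
  "chain_coeffs (Add _ _) a b = (1, 1, 0, 0)"
| "chain_coeffs (Sub _ _) a b = (1, - 1, 0, 0)"
| "chain_coeffs (Mul _ _) a b = (b, a, 1, 0)"
| "chain_coeffs (Div _ _) a b = (1 / b, - a / b\<^sup>2, - 1 / b\<^sup>2, a / b ^ 3)"
| "chain_coeffs (Exp _) a b = (exp a, 0, exp a / 2, 0)"
| "chain_coeffs (Ln _) a b = (1 / a, 0, - 1 / (2 * a\<^sup>2), 0)"

text \<open>Definedness at \<open>e = 0\<close> supplies the nonzero denominator and the positive
  argument of \<open>ln\<close>.\<close>

lemma gate_expands2:
  assumes operands: "\<And>y. y \<in> {left_operand g, right_operand g} \<Longrightarrow>
      expands2 (\<lambda>e. operand_val (X e) (V e) y) (L y) (Q y)"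
    and "gate_defined (X 0) (V 0) g"
    and coeffs: "chain_coeffs g (operand_val (X 0) (V 0) (left_operand g))
      (operand_val (X 0) (V 0) (right_operand g)) = (\<alpha>, \<beta>, \<gamma>, \<delta>)"
  shows "expands2 (\<lambda>e. gate_val (X e) (V e) g)
    (\<alpha> * L (left_operand g) + \<beta> * L (right_operand g))
    (\<alpha> * Q (left_operand g) + \<beta> * Q (right_operand g)
      + L (right_operand g) * (\<gamma> * L (left_operand g) + \<delta> * L (right_operand g)))"
proof (cases g)
  case (Add p q)
  with expands2_add[OF operands operands, of p q] coeffs show ?thesis by auto
next
  case (Sub p q)
  with expands2_diff[OF operands operands, of p q] coeffs show ?thesis by auto
next
  case (Mul p q)
  with expands2_mult[OF operands operands, of p q] coeffs show ?thesis
    by (auto simp: algebra_simps)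
next
  case (Div p q)
  let ?a = "operand_val (X 0) (V 0) p" and ?b = "operand_val (X 0) (V 0) q"
  have b: "?b \<noteq> 0"
    using assms(2) Div by simp
  \<comment> \<open>A quotient is treated as a product with a reciprocal.\<close>
  have "expands2 (\<lambda>e. operand_val (X e) (V e) p * inverse (operand_val (X e) (V e) q))
      (?a * (- 1 / ?b\<^sup>2 * L q) + L p * inverse ?b)
      (?a * (- 1 / ?b\<^sup>2 * Q q + 1 / ?b ^ 3 * (L q)\<^sup>2) + Q p * inverse ?b
        + L p * (- 1 / ?b\<^sup>2 * L q))"
    using expands2_mult[OF operands expands2_inverse[OF operands], of p q] b Div by simp
  moreover have "?a * (- 1 / ?b\<^sup>2 * L q) + L p * inverse ?b = \<alpha> * L p + \<beta> * L q"
    using coeffs Div by (auto simp: divide_inverse)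
  moreover have "?a * (- 1 / ?b\<^sup>2 * Q q + 1 / ?b ^ 3 * (L q)\<^sup>2) + Q p * inverse ?b
      + L p * (- 1 / ?b\<^sup>2 * L q) = \<alpha> * Q p + \<beta> * Q q + L q * (\<gamma> * L p + \<delta> * L q)"
    using coeffs Div by (auto simp: divide_inverse algebra_simps power2_eq_square)
  ultimately show ?thesis
    using Div by (simp add: divide_inverse)
next
  case (Exp p)
  with expands2_exp[OF operands, of p] coeffs show ?thesis
    by (auto simp: power2_eq_square algebra_simps)
next
  case (Ln p)
  with expands2_ln[OF operands, of p] coeffs assms(2) show ?thesis
    by (auto simp: power2_eq_square algebra_simps)
qed

text \<open>Gate \<open>j\<close> of the given circuit becomes the block of gates \<open>11 j, \<dots>, 11 j + 10\<close>, of which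
  number \<open>11 j + 2\<close> computes \<open>L\<close> and number \<open>11 j + 10\<close> computes \<open>Q\<close>.\<close>

fun lin_operand :: "operand \<Rightarrow> operand" where
  "lin_operand (Gate i) = Gate (11 * i + 2)"
| "lin_operand (Input i) = Input i"
| "lin_operand (Const a) = Const 0"

fun quad_operand :: "operand \<Rightarrow> operand" where
  "quad_operand (Gate i) = Gate (11 * i + 10)"
| "quad_operand (Input i) = Const 0"
| "quad_operand (Const a) = Const 0"

text \<open>The coefficients enter as \<open>Const\<close> operands, so exponentials, logarithms and
  quotients survive only as real constants. Gate \<open>b + 6\<close> is the one product that is not
  a scaling by a coefficient.\<close>

fun chain_block ::
  "nat \<Rightarrow> real \<times> real \<times> real \<times> real \<Rightarrow> operand \<Rightarrow> operand \<Rightarrow> operand \<Rightarrow> operand \<Rightarrow> gate list" where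
  "chain_block b (\<alpha>, \<beta>, \<gamma>, \<delta>) l1 l2 q1 q2 =
    [Mul (Const \<alpha>) l1,
     Mul (Const \<beta>) l2,
     Add (Gate b) (Gate (b + 1)),
     Mul (Const \<gamma>) l1,
     Mul (Const \<delta>) l2,
     Add (Gate (b + 3)) (Gate (b + 4)),
     Mul l2 (Gate (b + 5)),
     Mul (Const \<alpha>) q1,
     Mul (Const \<beta>) q2,
     Add (Gate (b + 7)) (Gate (b + 8)),
     Add (Gate (b + 9)) (Gate (b + 6))]"

lemma length_chain_block [simp]: "length (chain_block b cs l1 l2 q1 q2) = 11"
  by (cases cs) simp

lemma chain_block_ok:
  assumes "operand_ok n b l1" "operand_ok n b l2" "operand_ok n b q1" "operand_ok n b q2"
    and "i < 11"
  shows "gate_ok n (b + i) (chain_block b cs l1 l2 q1 q2 ! i)"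
proof -
  have "i \<in> {0, 1, 2, 3, 4, 5, 6, 7, 8, 9, 10}"
    using assms(5) by simp arith
  thus ?thesis
    using assms(1-4) by (cases cs) (auto simp: operand_ok_mono)
qed

lemma chain_block_arith:
  assumes "g \<in> set (chain_block b cs l1 l2 q1 q2)"
  shows "arith_gate g" "gate_defined x vs g"
  using assms by (cases cs; auto)+

lemma chain_block_vals:
  fixes x :: "real list" and gs :: "gate list"
  assumes "operand_ok n (length gs) l1" "operand_ok n (length gs) l2"
    and "operand_ok n (length gs) q1" "operand_ok n (length gs) q2"
  defines "v \<equiv> operand_val x (gate_vals x gs)"
  shows "\<exists>ws. gate_vals x (gs @ chain_block (length gs) (\<alpha>, \<beta>, \<gamma>, \<delta>) l1 l2 q1 q2)
      = gate_vals x gs @ ws \<and> ws ! 2 = \<alpha> * v l1 + \<beta> * v l2 \<and>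
      ws ! 10 = \<alpha> * v q1 + \<beta> * v q2 + v l2 * (\<gamma> * v l1 + \<delta> * v l2)"
proof -
  let ?hs = "chain_block (length gs) (\<alpha>, \<beta>, \<gamma>, \<delta>) l1 l2 q1 q2"
  obtain ws where ws: "gate_vals x (gs @ ?hs) = gate_vals x gs @ ws"
    using gate_vals_prefix by blast
  have v: "operand_val x (gate_vals x gs @ ws) y = v y" if "y \<in> {l1, l2, q1, q2}" for y
    unfolding v_def using that assms(1-4) by (intro operand_val_append[of n]) auto
  have shift: "(gate_vals x gs @ ws) ! (length gs + i) = ws ! i" for i
    by (metis length_gate_vals nth_append_length_plus)
  have eqs: "ws ! i = gate_val x (gate_vals x gs @ ws) (?hs ! i)" if "i < 11" for i
    using gate_vals_nth[of "length gs + i" "gs @ ?hs" n x] chain_block_ok[OF assms(1-4) that]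
      that by (simp add: ws shift nth_append del: chain_block.simps)
  \<comment> \<open>The offsets 0 and 1 are simplified to a shape that \<open>shift\<close> itself
    does not match.\<close>
  note shift01 = shift[of 0, simplified] shift[of 1, simplified]
  show ?thesis
    using eqs[of 0] eqs[of 1] eqs[of 2] eqs[of 3] eqs[of 4] eqs[of 5] eqs[of 6] eqs[of 7] eqs[of 8]
      eqs[of 9] eqs[of 10] ws
    by (intro exI[of _ ws]) (simp add: v shift shift01 del: length_gate_vals)
qed

text \<open>The coefficients are taken from the values at the origin, so the block is one fixed list
  of gates, the same for every input.\<close>

definition expansion_block :: "nat \<Rightarrow> gate list \<Rightarrow> gate \<Rightarrow> gate list" where
  "expansion_block n gs g =
    (let v = operand_val (replicate n 0) (gate_vals (replicate n 0) gs);
         y = left_operand g; z = right_operand g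
     in chain_block (11 * length gs) (chain_coeffs g (v y) (v z))
          (lin_operand y) (lin_operand z) (quad_operand y) (quad_operand z))"

definition expansion_gates :: "nat \<Rightarrow> gate list \<Rightarrow> gate list" where
  "expansion_gates n gs = concat (map (\<lambda>j. expansion_block n (take j gs) (gs ! j)) [0..<length gs])"

lemma expansion_gates_Nil [simp]: "expansion_gates n [] = []"
  by (simp add: expansion_gates_def)

lemma expansion_gates_snoc:
  "expansion_gates n (gs @ [g]) = expansion_gates n gs @ expansion_block n gs g"
proof -
  have "map (\<lambda>j. expansion_block n (take j (gs @ [g])) ((gs @ [g]) ! j)) [0..<length gs]
      = map (\<lambda>j. expansion_block n (take j gs) (gs ! j)) [0..<length gs]"
    by (intro map_cong) (auto simp: nth_append)
  moreover have "take (length gs) (gs @ [g]) = gs"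
    by simp
  ultimately show ?thesis
    by (simp add: expansion_gates_def del: take_append map_eq_conv)
qed

lemma length_expansion_gates [simp]: "length (expansion_gates n gs) = 11 * length gs"
  by (induction gs rule: rev_induct)
     (simp_all add: expansion_gates_snoc expansion_block_def Let_def)

lemma expanded_operands_ok:
  assumes "gate_ok n j g" "y \<in> {left_operand g, right_operand g}"
  shows "operand_ok n j y" "operand_ok n (11 * j) (lin_operand y)"
    "operand_ok n (11 * j) (quad_operand y)"
proof -
  show "operand_ok n j y"
    using assms by (cases g) auto
  thus "operand_ok n (11 * j) (lin_operand y)" "operand_ok n (11 * j) (quad_operand y)"
    by (cases y; auto)+
qed

text \<open>Blocks contain only additions and multiplications, hence are defined for arbitrary
  \<open>x\<close> and \<open>vs\<close>.\<close>

lemma expansion_gates_ok: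
  assumes "\<And>j. j < length gs \<Longrightarrow> gate_ok n j (gs ! j)" and "i < 11 * length gs"
  shows "gate_ok n i (expansion_gates n gs ! i) \<and> arith_gate (expansion_gates n gs ! i) \<and>
    gate_defined x vs (expansion_gates n gs ! i)"
  using assms
proof (induction gs rule: rev_induct)
  case (snoc g gs)
  have ok: "gate_ok n j (gs ! j)" if "j < length gs" for j
    using snoc.prems(1)[of j] that by (simp add: nth_append)
  have g: "gate_ok n (length gs) g"
    using snoc.prems(1)[of "length gs"] by simp
  show ?case
  proof (cases "i < 11 * length gs")
    case True
    with snoc.IH ok show ?thesis
      by (simp add: expansion_gates_snoc nth_append)
  next
    case False
    then obtain k where "i = 11 * length gs + k" "k < 11"
      using snoc.prems(2) by (auto simp: not_less dest!: le_Suc_ex)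
    thus ?thesis
      using expanded_operands_ok[OF g]
      by (simp add: expansion_gates_snoc nth_append expansion_block_def Let_def chain_block_ok
          chain_block_arith[OF nth_mem])
  qed
qed simp

text \<open>The old circuit runs along the ray through \<open>x\<close>, the new one at
  \<open>x\<close> itself. Induction over the gates applies the chain rule to the last gate, whose
  operands expand by the induction hypothesis.\<close>

lemma expansion_gates_correct:
  assumes "\<And>j. j < length gs \<Longrightarrow> gate_ok n j (gs ! j)"
    and "\<And>j. j < length gs \<Longrightarrow>
      gate_defined (replicate n 0) (gate_vals (replicate n 0) (take j gs)) (gs ! j)"
    and "length x = n" and "j < length gs"
  shows "expands2 (\<lambda>e. gate_vals (map ((*) e) x) gs ! j)
    (gate_vals x (expansion_gates n gs) ! (11 * j + 2))
    (gate_vals x (expansion_gates n gs) ! (11 * j + 10))"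
  using assms
proof (induction gs arbitrary: j rule: rev_induct)
  case (snoc g gs)
  have IH: "expands2 (\<lambda>e. gate_vals (map ((*) e) x) gs ! i)
      (gate_vals x (expansion_gates n gs) ! (11 * i + 2))
      (gate_vals x (expansion_gates n gs) ! (11 * i + 10))" if "i < length gs" for i
  proof (rule snoc.IH)
    fix k assume k: "k < length gs"
    show "gate_ok n k (gs ! k)"
      using snoc.prems(1)[of k] k by (simp add: nth_append)
    show "gate_defined (replicate n 0) (gate_vals (replicate n 0) (take k gs)) (gs ! k)"
      using snoc.prems(2)[of k] k by (simp add: nth_append)
  qed (use snoc.prems that in auto)
  have g: "gate_ok n (length gs) g"
    using snoc.prems(1)[of "length gs"] by simp
  note ok = expanded_operands_ok[OF g]
  define y z where "y = left_operand g" and "z = right_operand g"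
  define X where "X e = map ((*) e) x" for e
  define V where "V e = gate_vals (X e) gs" for e
  define w where "w = operand_val x (gate_vals x (expansion_gates n gs))"
  \<comment> \<open>Every ray starts at the origin, where the coefficients of the blocks were
    computed.\<close>
  have X0: "X 0 = replicate n 0"
    using snoc.prems(3) by (auto simp: X_def intro: nth_equalityI)
  obtain \<alpha> \<beta> \<gamma> \<delta> where cs:
    "chain_coeffs g (operand_val (X 0) (V 0) y) (operand_val (X 0) (V 0) z) = (\<alpha>, \<beta>, \<gamma>, \<delta>)"
    by (metis prod_cases4)
  have operands: "expands2 (\<lambda>e. operand_val (X e) (V e) u) (w (lin_operand u)) (w (quad_operand u))"
    if "u \<in> {left_operand g, right_operand g}" for u
    using ok(1)[OF that] IH expands2_const expands2_linear snoc.prems(3)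
    by (cases u) (auto simp: V_def X_def w_def)
  have "gate_defined (X 0) (V 0) g"
    using snoc.prems(2)[of "length gs"] by (simp add: X0 V_def)
  from gate_expands2[of g X V "\<lambda>u. w (lin_operand u)" "\<lambda>u. w (quad_operand u)", OF operands this]
  have new: "expands2 (\<lambda>e. gate_val (X e) (V e) g)
      (\<alpha> * w (lin_operand y) + \<beta> * w (lin_operand z))
      (\<alpha> * w (quad_operand y) + \<beta> * w (quad_operand z)
        + w (lin_operand z) * (\<gamma> * w (lin_operand y) + \<delta> * w (lin_operand z)))"
    using cs by (simp add: y_def z_def)
  have "expansion_block n gs g = chain_block (length (expansion_gates n gs)) (\<alpha>, \<beta>, \<gamma>, \<delta>)
      (lin_operand y) (lin_operand z) (quad_operand y) (quad_operand z)"
    using cs by (simp add: expansion_block_def Let_def y_def z_def X0 V_def)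
  then obtain ws where ws:
    "gate_vals x (expansion_gates n (gs @ [g])) = gate_vals x (expansion_gates n gs) @ ws"
    "ws ! 2 = \<alpha> * w (lin_operand y) + \<beta> * w (lin_operand z)"
    "ws ! 10 = \<alpha> * w (quad_operand y) + \<beta> * w (quad_operand z)
        + w (lin_operand z) * (\<gamma> * w (lin_operand y) + \<delta> * w (lin_operand z))"
    using chain_block_vals[of n "expansion_gates n gs" "lin_operand y" "lin_operand z"
        "quad_operand y" "quad_operand z" x \<alpha> \<beta> \<gamma> \<delta>] ok
    by (auto simp: expansion_gates_snoc y_def z_def w_def)
  show ?case
  proof (cases "j < length gs")
    case True
    with IH[OF True] show ?thesis
      by (simp add: ws(1) gate_vals_snoc nth_append)
  next
    case False
    hence "j = length gs"
      using snoc.prems(4) by simp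
    with new show ?thesis
      by (simp add: ws gate_vals_snoc nth_append X_def V_def)
  qed
qed simp

section \<open>Homogeneity of quadratic maps and the final circuit\<close>

lemma quadratic_map_scale:
  assumes "length x = n" "i < m"
  shows "quadratic_map n m t (map ((*) e) x) ! i = e\<^sup>2 * quadratic_map n m t x ! i"
  using assms by (simp add: quadratic_map_def sum_distrib_left power2_eq_square algebra_simps)

theorem theorem4p1:
  "\<exists>C::nat. \<forall>(n::nat) (m::nat) (t :: nat \<Rightarrow> nat \<Rightarrow> nat \<Rightarrow> real) (s::nat).
     (\<exists>E. ext_arith_circuit n E \<and> circuit_size E = s \<and> computes n E (quadratic_map n m t)) \<longrightarrow>
     (\<exists>A. arith_circuit n A \<and> circuit_size A \<le> C * s \<and> computes n A (quadratic_map n m t))"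
proof (intro exI[of _ 11] allI impI, elim exE conjE)
  fix n m s :: nat and t :: "nat \<Rightarrow> nat \<Rightarrow> nat \<Rightarrow> real" and E
  assume E: "ext_arith_circuit n E" "circuit_size E = s" "computes n E (quadratic_map n m t)"
  define gs where "gs = gates E"
  \<comment> \<open>Each output moves to the gate for \<open>Q\<close> in its block; the block
    length 11 is the constant in the size bound.\<close>
  define A where "A = Circuit (expansion_gates n gs) (map (\<lambda>j. 11 * j + 10) (outputs E))"
  have gs_ok: "gate_ok n j (gs ! j)" if "j < length gs" for j
    using E(1) that by (simp add: ext_arith_circuit_def gs_def)
  have outs: "distinct (outputs E)" "set (outputs E) \<subseteq> {..<length gs}"
    using E(1) by (auto simp: ext_arith_circuit_def gs_def)
  have gs_def0: "gate_defined (replicate n 0) (gate_vals (replicate n 0) (take j gs)) (gs ! j)"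
    if "j < length gs" for j
    using E(3) that by (auto simp: computes_def well_defined_on_def gs_def)
  have A_gates: "gate_ok n i (gates A ! i)" "arith_gate (gates A ! i)"
    "gate_defined x vs (gates A ! i)" if "i < length (gates A)" for i x vs
    using expansion_gates_ok[of gs n i x vs] gs_ok that by (auto simp: A_def)
  have "arith_circuit n A"
    unfolding arith_circuit_def ext_arith_circuit_def
  proof (intro conjI allI impI ballI)
    show "distinct (outputs A)"
      using outs(1) by (auto simp: A_def distinct_map inj_on_def)
    show "set (outputs A) \<subseteq> {..<length (gates A)}"
      using outs(2) by (fastforce simp: A_def)
    fix g assume "g \<in> set (gates A)"
    thus "arith_gate g"
      using A_gates(2) by (metis in_set_conv_nth)
  qed (rule A_gates)
  moreover have "circuit_size A \<le> 11 * s"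
    using E(2) by (simp add: circuit_size_def A_def gs_def)
  moreover have "output_vals x A = quadratic_map n m t x" if x: "length x = n" for x
  proof (rule nth_equalityI)
    have out: "output_vals (map ((*) e) x) E = quadratic_map n m t (map ((*) e) x)" for e
      using E(3) x by (simp add: computes_def)
    \<comment> \<open>The number of outputs is read off from a single evaluation, here at
      \<open>e = 1\<close>.\<close>
    have "length (outputs E) = m"
      using arg_cong[OF out[of 1], of length] by (simp add: output_vals_def quadratic_map_def)
    thus "length (output_vals x A) = length (quadratic_map n m t x)"
      by (simp add: output_vals_def quadratic_map_def A_def)
    fix i assume "i < length (output_vals x A)"
    hence i: "i < length (outputs E)" "i < m"
      using \<open>length (outputs E) = m\<close> by (auto simp: output_vals_def A_def)
    define j where "j = outputs E ! i"
    have j: "j < length gs"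
      using outs(2) nth_mem[OF i(1)] by (auto simp: j_def)
    \<comment> \<open>Along the ray an output gate is a pure multiple of e^2, so its second-order
      coefficient must be the value of the quadratic form at \<open>x\<close>.\<close>
    have "gate_vals (map ((*) e) x) gs ! j = e\<^sup>2 * quadratic_map n m t x ! i" for e
      using arg_cong[OF out[of e], of "\<lambda>vs. vs ! i"] i x
      by (simp add: output_vals_def j_def gs_def quadratic_map_scale)
    hence "expands2 (\<lambda>e. e\<^sup>2 * quadratic_map n m t x ! i)
        (gate_vals x (expansion_gates n gs) ! (11 * j + 2))
        (gate_vals x (expansion_gates n gs) ! (11 * j + 10))"
      using expansion_gates_correct[OF gs_ok gs_def0 x j] by simp
    from expands2_homogeneous[OF this]
    show "output_vals x A ! i = quadratic_map n m t x ! i"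
      using i by (simp add: output_vals_def A_def j_def)
  qed
  ultimately show "\<exists>A. arith_circuit n A \<and> circuit_size A \<le> 11 * s \<and>
      computes n A (quadratic_map n m t)"
    using A_gates(3) by (auto simp: computes_def well_defined_on_def)
qed

end
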